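(* Let $\ell\in[0,1)$ and suppose that the entries of the random vector $\sigma$ in $\mathbb{R}^J$ are i.i.d. $\ell$-sparse, and that $\Phi\in L^2_{\mu_0}(\mathcal{U})$, where $\Phi(u)=\frac12\|\Gamma^{-1/2}(y-G(u))\|^2$. Let $\sigma^{(1)},\dots,\sigma^{(N)}$ be i.i.d. copies of $\sigma$, let $\nu_N$ be their joint distribution, and let $$\Phi_N(u)=\frac{1}{2N}\sum_{i=1}^N \left| {\sigma^{(i)}}^{\top}\left(\Gamma^{-1/2}(y-G(u))\right)\right|^2 .$$ Then there exists a constant $C$, independent of $N$, such that for all $N\in\mathbb{N}$ $$\left( \mathbb{E}_{\nu_N}\left[ d_{\mathrm{H}}(\mu,\mu_N^{\mathrm{S}})^2 \right]\right)^{1/2} \le \frac{C}{\sqrt{N}} .$$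
   Context: $\mathcal{U}$ is a separable Banach space with its Borel $\sigma$-algebra, $\mu_0$ is a probability measure (prior) on it, $y\in\mathbb{R}^J$ ($J\in\mathbb{N}$) is fixed data, $\Gamma$ is a symmetric positive-definite $J\times J$ matrix, $G:\mathcal{U}\to\mathbb{R}^J$ is measurable, and $\|\cdot\|$ is the Euclidean norm. The random vectors $\sigma^{(i)}$ are independent of $u$. The $\ell$-sparse distribution: with $s:=\frac{1}{1-\ell}\ge 1$, a real random variable $\sigma_j$ is $\ell$-sparse if it equals $\sqrt{s}$ with probability $\frac{1}{2s}$, $0$ with probability $\ell=1-\frac1s$, and $-\sqrt{s}$ with probability $\frac{1}{2s}$. (So $\sigma$ has mean zero and identity covariance.) The exact posterior $\mu$ and the random (sample) approximate posterior $\mu_N^{\mathrm{S}}$ are given by $\frac{d\mu}{d\mu_0}(u)=\exp(-\Phi(u))/Z$ with $Z=\mathbb{E}_{\mu_0}[\exp(-\Phi)]\in(0,\infty)$, and $\frac{d\mu_N^{\mathrm{S}}}{d\mu_0}(u)=\exp(-\Phi_N(u))/Z_N^{\mathrm{S}}$ with $Z_N^{\mathrm{S}}=\mathbb{E}_{\mu_0}[\exp(-\Phi_N)]$ (expectation over $u\sim\mu_0$ for fixed $\sigma^{(1)},\dots,\sigma^{(N)}$). The Hellinger distance of probability measures $\mu,\nu$ absolutely continuous with respect to a reference measure $\pi$ is $d_{\mathrm{H}}(\mu,\nu)^2 := \frac12\int_{\mathcal{U}} \left| \sqrt{d\mu/d\pi}-\sqrt{d\nu/d\pi}\right|^2 d\pi$.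 *)

theory Defs
  imports "HOL-Probability.Probability"
begin

definition sym_pos_def :: "real^'j^'j \<Rightarrow> bool" where
  "sym_pos_def A \<longleftrightarrow> transpose A = A \<and> (\<forall>x. x \<noteq> 0 \<longrightarrow> x \<bullet> (A *v x) > 0)"

(* A^(-1/2).  For symmetric positive definite A the principal square root of the inverse
   exists and is unique, so THE picks it out; for any other A the value is irrelevant. *)
definition inv_sqrt_matrix :: "real^'j^'j \<Rightarrow> real^'j^'j" where
  "inv_sqrt_matrix A = (THE B. sym_pos_def B \<and> B ** B = matrix_inv A)"

definition misfit :: "real^'j^'j \<Rightarrow> real^'j \<Rightarrow> ('a \<Rightarrow> real^'j) \<Rightarrow> 'a \<Rightarrow> real" where
  "misfit \<Gamma> y G u = 1 / 2 * (norm (inv_sqrt_matrix \<Gamma> *v (y - G u)))\<^sup>2"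

definition sample_misfit ::
  "real^'j^'j \<Rightarrow> real^'j \<Rightarrow> ('a \<Rightarrow> real^'j) \<Rightarrow> nat \<Rightarrow> (nat \<Rightarrow> real^'j) \<Rightarrow> 'a \<Rightarrow> real" where
  "sample_misfit \<Gamma> y G N s u =
     1 / (2 * real N) * (\<Sum>i=1..N. \<bar>s i \<bullet> (inv_sqrt_matrix \<Gamma> *v (y - G u))\<bar>\<^sup>2)"

definition posterior :: "'a measure \<Rightarrow> ('a \<Rightarrow> real) \<Rightarrow> 'a measure" where
  "posterior \<mu>0 \<Phi> = density \<mu>0 (\<lambda>u. ennreal (exp (- \<Phi> u) / (\<integral>v. exp (- \<Phi> v) \<partial>\<mu>0)))"

(* The first argument is the reference measure. *)
definition hellinger_dist :: "'a measure \<Rightarrow> 'a measure \<Rightarrow> 'a measure \<Rightarrow> real" where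
  "hellinger_dist \<pi> \<mu> \<nu> =
     sqrt (1 / 2 * (\<integral>u. \<bar>sqrt (enn2real (RN_deriv \<pi> \<mu> u))
                        - sqrt (enn2real (RN_deriv \<pi> \<nu> u))\<bar>\<^sup>2 \<partial>\<pi>))"

definition sparse_rv :: "'w measure \<Rightarrow> real \<Rightarrow> ('w \<Rightarrow> real) \<Rightarrow> bool" where
  "sparse_rv P l X \<longleftrightarrow>
     (let s = 1 / (1 - l) in
        X \<in> borel_measurable P \<and>
        measure P {\<omega> \<in> space P. X \<omega> = sqrt s} = 1 / (2 * s) \<and>
        measure P {\<omega> \<in> space P. X \<omega> = 0} = l \<and>
        measure P {\<omega> \<in> space P. X \<omega> = - sqrt s} = 1 / (2 * s))"

definition iid_sparse_entries :: "'w measure \<Rightarrow> real \<Rightarrow> ('w \<Rightarrow> real^'j) \<Rightarrow> bool" where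
  "iid_sparse_entries P l \<sigma> \<longleftrightarrow>
     prob_space.indep_vars P (\<lambda>_. borel) (\<lambda>j \<omega>. \<sigma> \<omega> $ j) UNIV \<and>
     (\<forall>j. sparse_rv P l (\<lambda>\<omega>. \<sigma> \<omega> $ j))"

(* The copies may live on a probability space Q different from the space P of the original. *)
definition iid_copies ::
  "'w measure \<Rightarrow> ('w \<Rightarrow> real^'j) \<Rightarrow> 'v measure \<Rightarrow> 'i set \<Rightarrow> ('i \<Rightarrow> 'v \<Rightarrow> real^'j) \<Rightarrow> bool" where
  "iid_copies P \<sigma> Q I \<tau> \<longleftrightarrow>
     prob_space.indep_vars Q (\<lambda>_. borel) \<tau> I \<and>
     (\<forall>i\<in>I. distr Q borel (\<tau> i) = distr P borel \<sigma>)"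

definition joint_law ::
  "'v measure \<Rightarrow> 'i set \<Rightarrow> ('i \<Rightarrow> 'v \<Rightarrow> real^'j) \<Rightarrow> ('i \<Rightarrow> real^'j) measure" where
  "joint_law Q I \<tau> = distr Q (PiM I (\<lambda>_. borel)) (\<lambda>\<omega>. \<lambda>i\<in>I. \<tau> i \<omega>)"

end

theory Submission
  imports Defs
begin

text \<open>
  The Hellinger distance between two posteriors is the distance between two normalised vectors of
  \<open>L\<^sup>2(\<mu>0)\<close>, since \<open>sqrt (exp (- \<Phi>) / Z) = a / norm a\<close> with \<open>a = exp (- \<Phi> / 2)\<close> and
  \<open>Z = (norm a)\<^sup>2\<close>. Normalising two nonnegative functions increases their distance by at most the
  factor \<open>sqrt 2 / norm a\<close> (\<open>normalised_L2_distance_le\<close>), in which the norm of only one of the two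
  appears. Taking that one from the exact posterior, and using that \<open>exp (- x / 2)\<close> is
  \<open>1/2\<close>-Lipschitz for \<open>x \<ge> 0\<close>, the squared Hellinger distance is at most
  \<open>1 / (4 * Z)\<close> times the integral of \<open>(\<Phi> - \<Phi>\<^sub>N)\<^sup>2\<close> (\<open>hellinger_dist_posterior_le\<close>).
  The random normalising constant of the approximate posterior, which may be arbitrarily small,
  has disappeared, so no negative moment of it has to be controlled.

  By Tonelli's theorem it remains to bound the mean of \<open>(\<Phi> u - \<Phi>\<^sub>N u)\<^sup>2\<close> for each fixed \<open>u\<close>.
  For a fixed vector \<open>v\<close>, the squares of the inner products of \<open>v\<close> with the samples are independent,
  have mean \<open>(norm v)\<^sup>2\<close> because the sparse law has identity covariance, and almost surely lie between 0 and
  \<open>K * (norm v)\<^sup>2\<close> with \<open>K = J / (1 - l)\<close> because it has bounded support. So the mean square error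
  of their average is at most \<open>K\<^sup>2 * (norm v)^4 / N\<close>
  (\<open>sparse_sample_mean_square_error_le\<close>). With \<open>v\<close> the whitened residual this is \<open>1 / N\<close> times a
  multiple of \<open>(\<Phi> u)\<^sup>2\<close>, which is integrable by hypothesis.
\<close>

section \<open>Sums of independent centred variables\<close>

text \<open>
  Bienayme's identity. It is used twice: over the samples, to obtain the Monte Carlo rate, and over
  the coordinates of one sample, to see that independent standardised entries have identity
  covariance.
\<close>

lemma (in prob_space) expectation_sum_squared_indep:
  fixes X :: "'i \<Rightarrow> 'a \<Rightarrow> real"
  assumes fin: "finite I" and indep: "indep_vars (\<lambda>_. borel) X I"
    and sq: "\<And>i. i \<in> I \<Longrightarrow> integrable M (\<lambda>\<omega>. (X i \<omega>)\<^sup>2)"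
    and centred: "\<And>i. i \<in> I \<Longrightarrow> expectation (X i) = 0"
  shows "integrable M (\<lambda>\<omega>. (\<Sum>i\<in>I. X i \<omega>)\<^sup>2)"
    and "expectation (\<lambda>\<omega>. (\<Sum>i\<in>I. X i \<omega>)\<^sup>2) = (\<Sum>i\<in>I. expectation (\<lambda>\<omega>. (X i \<omega>)\<^sup>2))"
proof -
  have meas: "X i \<in> borel_measurable M" if "i \<in> I" for i
    using indep that unfolding indep_vars_def2 by auto
  have int: "integrable M (X i)" if "i \<in> I" for i
    using square_integrable_imp_integrable[OF meas[OF that] sq[OF that]] by simp
  have mixed: "integrable M (\<lambda>\<omega>. X i \<omega> * X j \<omega>)
      \<and> expectation (\<lambda>\<omega>. X i \<omega> * X j \<omega>) = (if i = j then expectation (\<lambda>\<omega>. (X i \<omega>)\<^sup>2) else 0)"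
    if ij: "i \<in> I" "j \<in> I" for i j
  proof (cases "i = j")
    case True
    then show ?thesis using sq[OF ij(1)] by (simp add: power2_eq_square)
  next
    case False
    have ind: "indep_vars (\<lambda>_. borel) X {i, j}"
      using indep_vars_subset[OF indep] ij by simp
    have int': "integrable M (X k)" if "k \<in> {i, j}" for k
      using that int ij by auto
    show ?thesis
      using indep_vars_integrable[OF _ ind int'] indep_vars_lebesgue_integral[OF _ ind int']
        False centred ij by simp
  qed
  have expand: "(\<Sum>i\<in>I. X i \<omega>)\<^sup>2 = (\<Sum>i\<in>I. \<Sum>j\<in>I. X i \<omega> * X j \<omega>)" for \<omega>
    by (simp add: power2_eq_square sum_product)
  show "integrable M (\<lambda>\<omega>. (\<Sum>i\<in>I. X i \<omega>)\<^sup>2)"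
    unfolding expand using mixed by (intro Bochner_Integration.integrable_sum) auto
  have "expectation (\<lambda>\<omega>. (\<Sum>i\<in>I. X i \<omega>)\<^sup>2)
      = (\<Sum>i\<in>I. \<Sum>j\<in>I. expectation (\<lambda>\<omega>. X i \<omega> * X j \<omega>))"
    unfolding expand using mixed
    by (subst Bochner_Integration.integral_sum, (intro Bochner_Integration.integrable_sum; simp),
        intro sum.cong refl, subst Bochner_Integration.integral_sum, auto)
  also have "\<dots> = (\<Sum>i\<in>I. \<Sum>j\<in>I. if i = j then expectation (\<lambda>\<omega>. (X i \<omega>)\<^sup>2) else 0)"
    using mixed by (intro sum.cong refl) auto
  also have "\<dots> = (\<Sum>i\<in>I. expectation (\<lambda>\<omega>. (X i \<omega>)\<^sup>2))"
    using fin by (intro sum.cong refl) simp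
  finally show "expectation (\<lambda>\<omega>. (\<Sum>i\<in>I. X i \<omega>)\<^sup>2) = (\<Sum>i\<in>I. expectation (\<lambda>\<omega>. (X i \<omega>)\<^sup>2))" .
qed

lemma (in prob_space) sample_mean_square_error_le:
  fixes X :: "nat \<Rightarrow> 'a \<Rightarrow> real"
  assumes N: "N \<ge> 1" and indep: "indep_vars (\<lambda>_. borel) X {1..N}"
    and mean: "\<And>i. i \<in> {1..N} \<Longrightarrow> expectation (X i) = m"
    and bounded: "\<And>i. i \<in> {1..N} \<Longrightarrow> AE \<omega> in M. \<bar>X i \<omega> - m\<bar> \<le> b"
  shows "integrable M (\<lambda>\<omega>. ((\<Sum>i=1..N. X i \<omega>) / real N - m)\<^sup>2)"
    and "expectation (\<lambda>\<omega>. ((\<Sum>i=1..N. X i \<omega>) / real N - m)\<^sup>2) \<le> b\<^sup>2 / real N"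
proof -
  define Y where "Y i \<omega> = X i \<omega> - m" for i \<omega>
  have X_meas: "X i \<in> borel_measurable M" if "i \<in> {1..N}" for i
    using indep that unfolding indep_vars_def2 by auto
  have Y_indep: "indep_vars (\<lambda>_. borel) Y {1..N}"
    unfolding Y_def by (rule indep_vars_compose2[OF indep]) simp
  have Y_meas: "Y i \<in> borel_measurable M" if "i \<in> {1..N}" for i
    using X_meas[OF that] unfolding Y_def by simp
  have Y_int: "integrable M (Y i)" if "i \<in> {1..N}" for i
    using bounded[OF that] Y_meas[OF that]
    by (intro integrable_const_bound[of _ b]) (auto simp: Y_def)
  have X_int: "integrable M (X i)" if "i \<in> {1..N}" for i
    using Bochner_Integration.integrable_add[OF Y_int[OF that], of "\<lambda>_. m"] by (simp add: Y_def)
  have Y_centred: "expectation (Y i) = 0" if "i \<in> {1..N}" for i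
    using X_int[OF that] mean[OF that] unfolding Y_def by (simp add: prob_space)
  have Y_sq_le: "AE \<omega> in M. (Y i \<omega>)\<^sup>2 \<le> b\<^sup>2" if "i \<in> {1..N}" for i
    using bounded[OF that]
    by eventually_elim (metis Y_def abs_ge_zero power2_abs power_mono)
  have Y_sq_int: "integrable M (\<lambda>\<omega>. (Y i \<omega>)\<^sup>2)" if "i \<in> {1..N}" for i
    using Y_sq_le[OF that] Y_meas[OF that]
    by (intro integrable_const_bound[of _ "b\<^sup>2"]) auto
  have error: "((\<Sum>i=1..N. X i \<omega>) / real N - m)\<^sup>2 = (\<Sum>i=1..N. Y i \<omega>)\<^sup>2 / (real N)\<^sup>2" for \<omega>
    using N by (simp add: Y_def sum_subtractf power_divide[symmetric] diff_divide_distrib)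
  note sum_sq = expectation_sum_squared_indep[OF _ Y_indep Y_sq_int Y_centred, simplified]
  show "integrable M (\<lambda>\<omega>. ((\<Sum>i=1..N. X i \<omega>) / real N - m)\<^sup>2)"
    unfolding error using sum_sq(1) by simp
  have "(\<Sum>i=1..N. expectation (\<lambda>\<omega>. (Y i \<omega>)\<^sup>2)) \<le> (\<Sum>i=1..N. b\<^sup>2)"
    using Y_sq_int Y_sq_le by (intro sum_mono integral_le_const) auto
  then have "expectation (\<lambda>\<omega>. (\<Sum>i=1..N. Y i \<omega>)\<^sup>2) \<le> real N * b\<^sup>2"
    using sum_sq(2) by simp
  then have "expectation (\<lambda>\<omega>. (\<Sum>i=1..N. Y i \<omega>)\<^sup>2) / (real N)\<^sup>2 \<le> real N * b\<^sup>2 / (real N)\<^sup>2"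
    by (rule divide_right_mono) simp
  also have "\<dots> = b\<^sup>2 / real N"
    using N by (simp add: power2_eq_square)
  finally show "expectation (\<lambda>\<omega>. ((\<Sum>i=1..N. X i \<omega>) / real N - m)\<^sup>2) \<le> b\<^sup>2 / real N"
    unfolding error by simp
qed

section \<open>The sparse distribution\<close>

text \<open>
  The three prescribed probabilities add up to 1, so almost surely \<open>X\<close> takes one of the three
  values and is a combination of two indicator functions.
\<close>

lemma (in prob_space) sparse_rv_moments:
  fixes X :: "'a \<Rightarrow> real"
  assumes l: "0 \<le> l" "l < 1" and X: "sparse_rv M l X"
  shows "X \<in> borel_measurable M"
    and "AE \<omega> in M. (X \<omega>)\<^sup>2 \<le> 1 / (1 - l)"
    and "expectation X = 0"
    and "expectation (\<lambda>\<omega>. (X \<omega>)\<^sup>2) = 1"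
proof -
  define s where "s = 1 / (1 - l)"
  define A where "A = {\<omega> \<in> space M. X \<omega> = sqrt s}"
  define B where "B = {\<omega> \<in> space M. X \<omega> = 0}"
  define C where "C = {\<omega> \<in> space M. X \<omega> = - sqrt s}"
  have s: "s > 0" using l by (simp add: s_def)
  show [measurable]: "X \<in> borel_measurable M"
    using X by (simp add: sparse_rv_def Let_def)
  have [measurable]: "A \<in> events" "B \<in> events" "C \<in> events"
    unfolding A_def B_def C_def by measurable
  have probs: "prob A = 1 / (2 * s)" "prob B = l" "prob C = 1 / (2 * s)"
    using X unfolding sparse_rv_def Let_def s_def[symmetric] A_def B_def C_def by auto
  have disj: "A \<inter> B = {}" "(A \<union> B) \<inter> C = {}"
    using s unfolding A_def B_def C_def by auto
  have "prob (A \<union> B \<union> C) = prob A + prob B + prob C"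
    using disj by (simp add: finite_measure_Union)
  also have "\<dots> = 1"
    using l unfolding probs by (simp add: s_def field_simps)
  finally have "AE \<omega> in M. \<omega> \<in> A \<union> B \<union> C"
    by (subst (asm) prob_eq_1) auto
  then have vals: "AE \<omega> in M. X \<omega> = sqrt s * (indicator A \<omega> - indicator C \<omega>)
      \<and> (X \<omega>)\<^sup>2 = s * (indicator A \<omega> + indicator C \<omega>) \<and> (X \<omega>)\<^sup>2 \<le> s"
    by (rule AE_mp) (use s in \<open>auto intro!: AE_I2 simp: A_def B_def C_def indicator_def\<close>)
  then show "AE \<omega> in M. (X \<omega>)\<^sup>2 \<le> 1 / (1 - l)"
    unfolding s_def[symmetric] by auto
  have "expectation X = expectation (\<lambda>\<omega>. sqrt s * (indicator A \<omega> - indicator C \<omega>))"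
    using vals by (intro integral_cong_AE) auto
  also have "\<dots> = sqrt s * (prob A - prob C)"
    by (simp add: Bochner_Integration.integral_diff integrable_real_indicator less_top[symmetric])
  finally show "expectation X = 0" by (simp add: probs)
  have "expectation (\<lambda>\<omega>. (X \<omega>)\<^sup>2) = expectation (\<lambda>\<omega>. s * (indicator A \<omega> + indicator C \<omega>))"
    using vals by (intro integral_cong_AE) auto
  also have "\<dots> = s * (prob A + prob C)"
    by (simp add: Bochner_Integration.integral_add integrable_real_indicator less_top[symmetric])
  finally show "expectation (\<lambda>\<omega>. (X \<omega>)\<^sup>2) = 1" using s by (simp add: probs)
qed

lemma (in prob_space) iid_sparse_entries_projection:
  fixes \<sigma> :: "'a \<Rightarrow> real^'j"
  assumes l: "0 \<le> l" "l < 1" and \<sigma>: "iid_sparse_entries M l \<sigma>"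
  shows "\<sigma> \<in> borel_measurable M"
    and "AE \<omega> in M. (norm (\<sigma> \<omega>))\<^sup>2 \<le> real CARD('j) / (1 - l)"
    and "expectation (\<lambda>\<omega>. (\<sigma> \<omega> \<bullet> v)\<^sup>2) = (norm v)\<^sup>2"
proof -
  have indep: "indep_vars (\<lambda>_. borel) (\<lambda>j \<omega>. \<sigma> \<omega> $ j) UNIV"
    and sparse: "\<And>j. sparse_rv M l (\<lambda>\<omega>. \<sigma> \<omega> $ j)"
    using \<sigma> by (auto simp: iid_sparse_entries_def)
  note entry = sparse_rv_moments[OF l sparse]
  note entry(1)[measurable]
  have vec: "(\<lambda>\<omega>. \<chi> j. \<sigma> \<omega> $ j) \<in> borel_measurable M"
    by (subst borel_measurable_euclidean_space)
       (auto simp: Basis_vec_def inner_axis)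
  then show "\<sigma> \<in> borel_measurable M" by simp
  have "AE \<omega> in M. \<forall>j. (\<sigma> \<omega> $ j)\<^sup>2 \<le> 1 / (1 - l)"
    using entry(2) by (simp add: AE_all_countable)
  then show "AE \<omega> in M. (norm (\<sigma> \<omega>))\<^sup>2 \<le> real CARD('j) / (1 - l)"
  proof eventually_elim
    case (elim \<omega>)
    have "(norm (\<sigma> \<omega>))\<^sup>2 = (\<Sum>j\<in>UNIV. (\<sigma> \<omega> $ j)\<^sup>2)"
      by (simp add: norm_vec_def L2_set_def sum_nonneg)
    also have "\<dots> \<le> (\<Sum>j\<in>(UNIV :: 'j set). 1 / (1 - l))"
      using elim by (intro sum_mono) auto
    finally show ?case by simp
  qed
  have "indep_vars (\<lambda>_. borel) (\<lambda>j \<omega>. \<sigma> \<omega> $ j * v $ j) UNIV"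
    by (rule indep_vars_compose2[OF indep]) simp
  moreover have "integrable M (\<lambda>\<omega>. (\<sigma> \<omega> $ j * v $ j)\<^sup>2)" for j
    unfolding power_mult_distrib
    using entry(2)[of j] by (intro integrable_mult_left integrable_const_bound[of _ "1 / (1 - l)"]) auto
  ultimately have "expectation (\<lambda>\<omega>. (\<Sum>j\<in>UNIV. \<sigma> \<omega> $ j * v $ j)\<^sup>2)
      = (\<Sum>j\<in>UNIV. expectation (\<lambda>\<omega>. (\<sigma> \<omega> $ j * v $ j)\<^sup>2))"
    using entry(3) by (intro expectation_sum_squared_indep) auto
  also have "\<dots> = (\<Sum>j\<in>UNIV. (v $ j)\<^sup>2)"
    by (simp add: power_mult_distrib entry(4))
  also have "\<dots> = (norm v)\<^sup>2"
    by (simp add: norm_vec_def L2_set_def sum_nonneg)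
  finally show "expectation (\<lambda>\<omega>. (\<sigma> \<omega> \<bullet> v)\<^sup>2) = (norm v)\<^sup>2"
    by (simp add: inner_vec_def)
qed

text \<open>
  Mean and bound of each squared projection depend only on the law of the sample, so they transfer
  from \<open>\<sigma>\<close> to its copies through the equality of laws.
\<close>

lemma sparse_sample_mean_square_error_le:
  fixes \<sigma> :: "'w \<Rightarrow> real^'j" and \<tau> :: "nat \<Rightarrow> 'v \<Rightarrow> real^'j"
  assumes l: "0 \<le> l" "l < 1" and P: "prob_space P" and \<sigma>: "iid_sparse_entries P l \<sigma>"
    and Q: "prob_space Q" and N: "N \<ge> 1" and copies: "iid_copies P \<sigma> Q {1..N} \<tau>"
  shows "integrable Q (\<lambda>\<omega>. ((\<Sum>i=1..N. (\<tau> i \<omega> \<bullet> v)\<^sup>2) / real N - (norm v)\<^sup>2)\<^sup>2)"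
    and "(\<integral>\<omega>. ((\<Sum>i=1..N. (\<tau> i \<omega> \<bullet> v)\<^sup>2) / real N - (norm v)\<^sup>2)\<^sup>2 \<partial>Q)
           \<le> (real CARD('j) / (1 - l) * (norm v)\<^sup>2)\<^sup>2 / real N"
proof -
  interpret P: prob_space P by fact
  interpret Q: prob_space Q by fact
  define K where "K = real CARD('j) / (1 - l)"
  have "1 - l \<le> real CARD('j)"
    using l by (metis One_nat_def Suc_leI diff_ge_0_iff_ge diff_le_eq le_add_same_cancel1
        of_nat_1 of_nat_mono order_trans zero_less_card_finite)
  then have K: "K \<ge> 1" using l by (simp add: K_def)
  note proj = P.iid_sparse_entries_projection[OF l \<sigma>]
  have indep: "Q.indep_vars (\<lambda>_. borel) \<tau> {1..N}"
    and law: "\<And>i. i \<in> {1..N} \<Longrightarrow> distr Q borel (\<tau> i) = distr P borel \<sigma>"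
    using copies by (auto simp: iid_copies_def)
  have meas: "\<tau> i \<in> borel_measurable Q" if "i \<in> {1..N}" for i
    using indep that unfolding Q.indep_vars_def2 by auto
  have sq_indep: "Q.indep_vars (\<lambda>_. borel) (\<lambda>i \<omega>. (\<tau> i \<omega> \<bullet> v)\<^sup>2) {1..N}"
    by (rule Q.indep_vars_compose2[OF indep]) simp
  have mean: "Q.expectation (\<lambda>\<omega>. (\<tau> i \<omega> \<bullet> v)\<^sup>2) = (norm v)\<^sup>2" if i: "i \<in> {1..N}" for i
  proof -
    have "Q.expectation (\<lambda>\<omega>. (\<tau> i \<omega> \<bullet> v)\<^sup>2) = (\<integral>x. (x \<bullet> v)\<^sup>2 \<partial>distr Q borel (\<tau> i))"
      using meas[OF i] by (subst integral_distr) auto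
    also have "\<dots> = P.expectation (\<lambda>\<omega>. (\<sigma> \<omega> \<bullet> v)\<^sup>2)"
      unfolding law[OF i] using proj(1) by (subst integral_distr) auto
    finally show ?thesis using proj(3) by simp
  qed
  have bounded: "AE \<omega> in Q. \<bar>(\<tau> i \<omega> \<bullet> v)\<^sup>2 - (norm v)\<^sup>2\<bar> \<le> K * (norm v)\<^sup>2" if i: "i \<in> {1..N}" for i
  proof -
    have "AE x in distr P borel \<sigma>. (norm x)\<^sup>2 \<le> K"
      using proj(1,2) by (subst AE_distr_iff) (auto simp: K_def)
    then have "AE \<omega> in Q. (norm (\<tau> i \<omega>))\<^sup>2 \<le> K"
      unfolding law[OF i, symmetric] using meas[OF i] by (subst (asm) AE_distr_iff) auto
    then show ?thesis
    proof eventually_elim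
      case (elim \<omega>)
      have "(\<tau> i \<omega> \<bullet> v)\<^sup>2 \<le> (norm (\<tau> i \<omega>) * norm v)\<^sup>2"
        using Cauchy_Schwarz_ineq2[of "\<tau> i \<omega>" v] by (metis abs_ge_zero power2_abs power_mono)
      also have "\<dots> \<le> K * (norm v)\<^sup>2"
        using elim by (simp add: power_mult_distrib mult_right_mono)
      finally have "(\<tau> i \<omega> \<bullet> v)\<^sup>2 \<le> K * (norm v)\<^sup>2" .
      \<comment> \<open>Two numbers between 0 and the bound differ by at most the bound; this needs \<open>K \<ge> 1\<close>.\<close>
      moreover have "(norm v)\<^sup>2 \<le> K * (norm v)\<^sup>2"
        using mult_right_mono[OF K, of "(norm v)\<^sup>2"] by simp
      moreover have "0 \<le> (\<tau> i \<omega> \<bullet> v)\<^sup>2" "0 \<le> (norm v)\<^sup>2" by simp_all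
      ultimately show ?case by linarith
    qed
  qed
  show "integrable Q (\<lambda>\<omega>. ((\<Sum>i=1..N. (\<tau> i \<omega> \<bullet> v)\<^sup>2) / real N - (norm v)\<^sup>2)\<^sup>2)"
    by (rule Q.sample_mean_square_error_le(1)[OF N sq_indep mean bounded])
  show "(\<integral>\<omega>. ((\<Sum>i=1..N. (\<tau> i \<omega> \<bullet> v)\<^sup>2) / real N - (norm v)\<^sup>2)\<^sup>2 \<partial>Q)
           \<le> (real CARD('j) / (1 - l) * (norm v)\<^sup>2)\<^sup>2 / real N"
    using Q.sample_mean_square_error_le(2)[OF N sq_indep mean bounded] by (simp add: K_def)
qed

section \<open>Stability of the posterior in the Hellinger distance\<close>

lemma exp_neg_half_diff_square_le:
  fixes x y :: real
  assumes "0 \<le> x" "0 \<le> y"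
  shows "(exp (- x / 2) - exp (- y / 2))\<^sup>2 \<le> (x - y)\<^sup>2 / 4"
proof -
  have *: "\<bar>exp (- a / 2) - exp (- b / 2)\<bar> \<le> \<bar>a - b\<bar> / 2" if "0 \<le> a" "a \<le> b" for a b :: real
  proof -
    have "exp (- a / 2) - exp (- b / 2) = exp (- a / 2) * (1 - exp (- (b - a) / 2))"
      by (simp add: right_diff_distrib exp_add[symmetric] field_simps)
    also have "\<dots> \<le> 1 * (1 - exp (- (b - a) / 2))"
      using that by (intro mult_right_mono) auto
    also have "\<dots> \<le> (b - a) / 2"
      using exp_ge_add_one_self[of "- (b - a) / 2"] by (simp add: field_simps)
    finally show ?thesis using that by simp
  qed
  have "\<bar>exp (- x / 2) - exp (- y / 2)\<bar> \<le> \<bar>x - y\<bar> / 2"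
    using *[of x y] *[of y x] assms by (metis abs_minus_commute linear)
  from power_mono[OF this, of 2] show ?thesis by (simp add: power_divide)
qed

text \<open>
  Let \<open>c\<close> be the cosine of the angle between \<open>a\<close> and \<open>b\<close>. The normalised vectors are at squared
  distance \<open>2 * (1 - c)\<close>. Since \<open>a\<close> and \<open>b\<close> are nonnegative, \<open>c \<ge> 0\<close>, so
  \<open>1 - c \<le> 1 - c\<^sup>2\<close>, and \<open>p\<^sup>2 * (1 - c\<^sup>2)\<close> is the squared distance from \<open>a\<close> to the line
  through \<open>b\<close>. The bound is free of \<open>q\<close>, which is what the application to a random second
  argument requires.
\<close>

lemma normalised_L2_distance_le:
  fixes a b :: "'a \<Rightarrow> real"
  assumes int: "integrable M (\<lambda>x. (a x)\<^sup>2)" "integrable M (\<lambda>x. (b x)\<^sup>2)" "integrable M (\<lambda>x. a x * b x)"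
    and nonneg: "\<And>x. 0 \<le> a x" "\<And>x. 0 \<le> b x"
    and p: "0 < p" "(\<integral>x. (a x)\<^sup>2 \<partial>M) = p\<^sup>2" and q: "0 < q" "(\<integral>x. (b x)\<^sup>2 \<partial>M) = q\<^sup>2"
  shows "(\<integral>x. (a x / p - b x / q)\<^sup>2 \<partial>M) \<le> 2 / p\<^sup>2 * (\<integral>x. (a x - b x)\<^sup>2 \<partial>M)"
proof -
  define t where "t = (\<integral>x. a x * b x \<partial>M)"
  have t: "0 \<le> t" unfolding t_def using nonneg by (intro integral_nonneg_AE) auto
  have combine: "(\<integral>x. (\<alpha> * a x - \<beta> * b x)\<^sup>2 \<partial>M) = \<alpha>\<^sup>2 * p\<^sup>2 + \<beta>\<^sup>2 * q\<^sup>2 - 2 * \<alpha> * \<beta> * t" for \<alpha> \<beta>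
  proof -
    have "(\<integral>x. (\<alpha> * a x - \<beta> * b x)\<^sup>2 \<partial>M)
        = (\<integral>x. \<alpha>\<^sup>2 * (a x)\<^sup>2 + \<beta>\<^sup>2 * (b x)\<^sup>2 - 2 * \<alpha> * \<beta> * (a x * b x) \<partial>M)"
      by (intro Bochner_Integration.integral_cong refl) (simp add: power2_eq_square algebra_simps)
    then show ?thesis using int by (simp add: p q t_def)
  qed
  have unit: "(\<integral>x. (a x / p - b x / q)\<^sup>2 \<partial>M) = 2 - 2 * t / (p * q)"
    using combine[of "1 / p" "1 / q"] p(1) q(1) by (simp add: power_divide)
  define c where "c = t / (p * q)"
  have c: "0 \<le> c" "t = c * p * q" using t p(1) q(1) by (simp_all add: c_def)
  have "0 \<le> (\<integral>x. (a x / p - b x / q)\<^sup>2 \<partial>M)"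
    by (intro integral_nonneg_AE) auto
  \<comment> \<open>This is the Cauchy-Schwarz inequality for \<open>a\<close> and \<open>b\<close>.\<close>
  then have "c \<le> 1" unfolding unit c_def by simp
  then have "1 - c \<le> (1 - c) * (1 + c)"
    using c(1) by (simp add: mult_le_cancel_left1)
  also have "\<dots> = (p\<^sup>2 * (1 - c\<^sup>2)) / p\<^sup>2"
    using p(1) by (simp add: field_simps power2_eq_square)
  also have "\<dots> \<le> (p\<^sup>2 + q\<^sup>2 - 2 * t) / p\<^sup>2"
  proof (rule divide_right_mono)
    have "p\<^sup>2 + q\<^sup>2 - 2 * t - p\<^sup>2 * (1 - c\<^sup>2) = (q - c * p)\<^sup>2"
      unfolding c(2) by (simp add: power2_eq_square algebra_simps)
    then show "p\<^sup>2 * (1 - c\<^sup>2) \<le> p\<^sup>2 + q\<^sup>2 - 2 * t"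
      by (metis diff_ge_0_iff_ge zero_le_power2)
  qed simp
  finally have "2 * (1 - c) \<le> 2 * ((p\<^sup>2 + q\<^sup>2 - 2 * t) / p\<^sup>2)"
    by (rule mult_left_mono) simp
  moreover have "(\<integral>x. (a x - b x)\<^sup>2 \<partial>M) = p\<^sup>2 + q\<^sup>2 - 2 * t"
    using combine[of 1 1] by simp
  moreover have "(\<integral>x. (a x / p - b x / q)\<^sup>2 \<partial>M) = 2 * (1 - c)"
    unfolding unit c_def by simp
  ultimately show ?thesis by simp
qed

lemma (in prob_space) hellinger_dist_density:
  assumes [measurable]: "f \<in> borel_measurable M" "g \<in> borel_measurable M"
    and nonneg: "\<And>x. 0 \<le> f x" "\<And>x. 0 \<le> g x"
  shows "(hellinger_dist M (density M (\<lambda>x. ennreal (f x))) (density M (\<lambda>x. ennreal (g x))))\<^sup>2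
           = 1 / 2 * (\<integral>x. (sqrt (f x) - sqrt (g x))\<^sup>2 \<partial>M)"
proof -
  have RN: "AE x in M. enn2real (RN_deriv M (density M (\<lambda>x. ennreal (h x))) x) = h x"
    if [measurable]: "h \<in> borel_measurable M" and "\<And>x. 0 \<le> h x" for h
  proof -
    have "AE x in M. ennreal (h x) = RN_deriv M (density M (\<lambda>x. ennreal (h x))) x"
      by (rule RN_deriv_unique) auto
    then show ?thesis by eventually_elim (metis enn2real_ennreal that(2))
  qed
  have "(\<integral>x. \<bar>sqrt (enn2real (RN_deriv M (density M (\<lambda>x. ennreal (f x))) x))
             - sqrt (enn2real (RN_deriv M (density M (\<lambda>x. ennreal (g x))) x))\<bar>\<^sup>2 \<partial>M)
      = (\<integral>x. (sqrt (f x) - sqrt (g x))\<^sup>2 \<partial>M)"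
    using RN[of f] RN[of g] nonneg by (intro integral_cong_AE) auto
  moreover have "0 \<le> (\<integral>x. (sqrt (f x) - sqrt (g x))\<^sup>2 \<partial>M)"
    by (intro integral_nonneg_AE) auto
  ultimately show ?thesis by (simp add: hellinger_dist_def)
qed

text \<open>
  The bound is stated for the extended integral, so that it also covers potentials with
  \<open>\<Phi> - \<Psi>\<close> not square-integrable and can be integrated over samples by Tonelli's theorem.
\<close>

lemma (in prob_space) hellinger_dist_posterior_le:
  fixes \<Phi> \<Psi> :: "'a \<Rightarrow> real"
  assumes [measurable]: "\<Phi> \<in> borel_measurable M" "\<Psi> \<in> borel_measurable M"
    and nonneg: "\<And>x. 0 \<le> \<Phi> x" "\<And>x. 0 \<le> \<Psi> x"
  defines "Z \<equiv> (\<integral>x. exp (- \<Phi> x) \<partial>M)"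
  shows "0 < Z"
    and "ennreal ((hellinger_dist M (posterior M \<Phi>) (posterior M \<Psi>))\<^sup>2)
           \<le> ennreal (1 / (4 * Z)) * (\<integral>\<^sup>+x. ennreal ((\<Phi> x - \<Psi> x)\<^sup>2) \<partial>M)"
proof -
  define W where "W = (\<integral>x. exp (- \<Psi> x) \<partial>M)"
  have int: "integrable M (\<lambda>x. exp (- h x))" and pos: "0 < (\<integral>x. exp (- h x) \<partial>M)"
    if [measurable]: "h \<in> borel_measurable M" and "\<And>x. 0 \<le> h x" for h :: "'a \<Rightarrow> real"
  proof -
    show int: "integrable M (\<lambda>x. exp (- h x))"
      using that by (intro integrable_const_bound[of _ 1]) auto
    show "0 < (\<integral>x. exp (- h x) \<partial>M)"
      using int by (intro expectation_greater) auto
  qed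
  show Z: "0 < Z" unfolding Z_def using nonneg by (intro pos) auto
  have W: "0 < W" unfolding W_def using nonneg by (intro pos) auto
  define a where "a x = exp (- \<Phi> x / 2)" for x
  define b where "b x = exp (- \<Psi> x / 2)" for x
  have [measurable]: "a \<in> borel_measurable M" "b \<in> borel_measurable M"
    unfolding a_def b_def by measurable
  have ab: "0 < a x" "a x \<le> 1" "0 < b x" "b x \<le> 1" for x
    using nonneg by (auto simp: a_def b_def)
  have a2: "(a x)\<^sup>2 = exp (- \<Phi> x)" and b2: "(b x)\<^sup>2 = exp (- \<Psi> x)" for x
    by (simp_all add: a_def b_def power2_eq_square exp_add[symmetric])
  have "a x * b x \<le> 1 * 1" for x using ab[of x] by (intro mult_mono) auto
  then have int_ab: "integrable M (\<lambda>x. a x * b x)"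
    using ab by (intro integrable_const_bound[of _ 1]) (auto simp: abs_mult less_imp_le)
  have int_a: "integrable M (\<lambda>x. (a x)\<^sup>2)" and int_b: "integrable M (\<lambda>x. (b x)\<^sup>2)"
    unfolding a2 b2 using nonneg by (auto intro: int)
  have "(hellinger_dist M (posterior M \<Phi>) (posterior M \<Psi>))\<^sup>2
      = 1 / 2 * (\<integral>x. (sqrt (exp (- \<Phi> x) / Z) - sqrt (exp (- \<Psi> x) / W))\<^sup>2 \<partial>M)"
    unfolding posterior_def Z_def[symmetric] W_def[symmetric]
    using Z W by (intro hellinger_dist_density) auto
  also have "(\<integral>x. (sqrt (exp (- \<Phi> x) / Z) - sqrt (exp (- \<Psi> x) / W))\<^sup>2 \<partial>M)
      = (\<integral>x. (a x / sqrt Z - b x / sqrt W)\<^sup>2 \<partial>M)"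
    using ab by (simp add: real_sqrt_divide a2[symmetric] b2[symmetric] less_imp_le)
  also have "\<dots> \<le> 2 / (sqrt Z)\<^sup>2 * (\<integral>x. (a x - b x)\<^sup>2 \<partial>M)"
    using Z W int_a int_b int_ab ab
    by (intro normalised_L2_distance_le) (auto simp: Z_def W_def a2 b2 less_imp_le)
  finally have *: "(hellinger_dist M (posterior M \<Phi>) (posterior M \<Psi>))\<^sup>2
      \<le> 1 / Z * (\<integral>x. (a x - b x)\<^sup>2 \<partial>M)"
    using Z by simp
  have int_diff: "integrable M (\<lambda>x. (a x - b x)\<^sup>2)"
    unfolding power2_diff using int_a int_b int_ab
    by (auto simp: mult.assoc)
  have "ennreal ((hellinger_dist M (posterior M \<Phi>) (posterior M \<Psi>))\<^sup>2)
      \<le> ennreal (1 / Z) * ennreal (\<integral>x. (a x - b x)\<^sup>2 \<partial>M)"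
    using * Z by (subst ennreal_mult[symmetric]) (auto intro: ennreal_leI)
  also have "ennreal (\<integral>x. (a x - b x)\<^sup>2 \<partial>M) = (\<integral>\<^sup>+x. ennreal ((a x - b x)\<^sup>2) \<partial>M)"
    using int_diff by (subst nn_integral_eq_integral) auto
  also have "\<dots> \<le> (\<integral>\<^sup>+x. ennreal (1 / 4) * ennreal ((\<Phi> x - \<Psi> x)\<^sup>2) \<partial>M)"
    using nonneg exp_neg_half_diff_square_le unfolding a_def b_def
    by (intro nn_integral_mono) (auto simp: ennreal_mult[symmetric] intro!: ennreal_leI)
  also have "\<dots> = ennreal (1 / 4) * (\<integral>\<^sup>+x. ennreal ((\<Phi> x - \<Psi> x)\<^sup>2) \<partial>M)"
    by (rule nn_integral_cmult) simp
  finally show "ennreal ((hellinger_dist M (posterior M \<Phi>) (posterior M \<Psi>))\<^sup>2)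
      \<le> ennreal (1 / (4 * Z)) * (\<integral>\<^sup>+x. ennreal ((\<Phi> x - \<Psi> x)\<^sup>2) \<partial>M)"
    using Z by (simp add: mult.assoc[symmetric] ennreal_mult[symmetric] mult_left_mono mult.commute[of 4])
qed

section \<open>The convergence rate\<close>

theorem proposition4p1:
  fixes \<mu>0 :: "'a :: {banach, second_countable_topology} measure"
    and y :: "real^'j" and \<Gamma> :: "real^'j^'j" and G :: "'a \<Rightarrow> real^'j"
    and l :: real and P :: "'w measure" and \<sigma> :: "'w \<Rightarrow> real^'j"
  assumes "prob_space \<mu>0" and "sets \<mu>0 = sets borel"
    and "sym_pos_def \<Gamma>"
    and "G \<in> borel_measurable borel"
    and "0 \<le> l" and "l < 1"
    and "prob_space P" and "iid_sparse_entries P l \<sigma>"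
    and "integrable \<mu>0 (\<lambda>u. (misfit \<Gamma> y G u)\<^sup>2)"
  shows "\<exists>C::real. \<forall>N\<ge>1. \<forall>(Q :: 'v measure) (\<tau> :: nat \<Rightarrow> 'v \<Rightarrow> real^'j).
           prob_space Q \<longrightarrow> iid_copies P \<sigma> Q {1..N} \<tau> \<longrightarrow>
           sqrt (\<integral>s. (hellinger_dist \<mu>0 (posterior \<mu>0 (misfit \<Gamma> y G))
                         (posterior \<mu>0 (sample_misfit \<Gamma> y G N s)))\<^sup>2
                 \<partial>joint_law Q {1..N} \<tau>)
             \<le> C / sqrt (real N)"
proof -
  interpret \<mu>0: prob_space \<mu>0 by fact
  define f where "f u = inv_sqrt_matrix \<Gamma> *v (y - G u)" for u
  define \<Phi> where "\<Phi> = misfit \<Gamma> y G"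
  define Z where "Z = (\<integral>u. exp (- \<Phi> u) \<partial>\<mu>0)"
  define K where "K = real CARD('j) / (1 - l)"
  define R where "R = 1 / (4 * Z) * (K\<^sup>2 * (\<integral>u. (\<Phi> u)\<^sup>2 \<partial>\<mu>0))"
  have [measurable]: "G \<in> borel_measurable \<mu>0"
    using assms(4) measurable_cong_sets[OF assms(2) refl] by blast
  have "(\<lambda>x. inv_sqrt_matrix \<Gamma> *v x) \<in> borel_measurable borel"
    by (intro borel_measurable_continuous_onI linear_continuous_on
        linear_conv_bounded_linear[THEN iffD1] matrix_vector_mul_linear)
  from measurable_compose[OF _ this, of "\<lambda>u. y - G u" \<mu>0]
  have f_meas[measurable]: "f \<in> borel_measurable \<mu>0" unfolding f_def by simp
  have \<Phi>_eq: "\<Phi> u = 1 / 2 * (norm (f u))\<^sup>2" for u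
    by (simp add: \<Phi>_def misfit_def f_def)
  have sample_eq: "sample_misfit \<Gamma> y G N s u = 1 / 2 * ((\<Sum>i=1..N. (s i \<bullet> f u)\<^sup>2) / real N)" for N s u
    by (simp add: sample_misfit_def f_def)
  have \<Phi>_meas[measurable]: "\<Phi> \<in> borel_measurable \<mu>0" unfolding \<Phi>_eq[abs_def] by measurable
  have sample_meas[measurable]: "sample_misfit \<Gamma> y G N s \<in> borel_measurable \<mu>0" for N s
    unfolding sample_eq[abs_def] by measurable
  have \<Phi>_nonneg: "0 \<le> \<Phi> u" for u by (simp add: \<Phi>_eq)
  have sample_nonneg: "0 \<le> sample_misfit \<Gamma> y G N s u" for N s u
    by (simp add: sample_eq sum_nonneg)
  note stability = \<mu>0.hellinger_dist_posterior_le[OF \<Phi>_meas sample_meas \<Phi>_nonneg sample_nonneg,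
      folded Z_def]
  have Z: "0 < Z" by (rule stability(1))
  have R: "0 \<le> R" using Z by (simp add: R_def)
  \<comment> \<open>\<open>R\<close> is built from the prior, \<open>\<Phi>\<close>, \<open>l\<close> and the dimension only, so \<open>sqrt R\<close> serves as the
    constant for every sample size and every family of copies.\<close>
  have "sqrt (\<integral>s. (hellinger_dist \<mu>0 (posterior \<mu>0 \<Phi>) (posterior \<mu>0 (sample_misfit \<Gamma> y G N s)))\<^sup>2
                 \<partial>joint_law Q {1..N} \<tau>) \<le> sqrt R / sqrt (real N)"
    if N: "N \<ge> 1" and Q: "prob_space Q" and copies: "iid_copies P \<sigma> Q {1..N} \<tau>"
    for N and Q :: "'v measure" and \<tau>
  proof -
    interpret Q: prob_space Q by fact
    interpret pair_sigma_finite Q \<mu>0 ..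
    have [measurable]: "\<tau> i \<in> borel_measurable Q" if "i \<in> {1..N}" for i
      using copies that unfolding iid_copies_def Q.indep_vars_def2 by auto
    define E where "E s u = (\<Phi> u - sample_misfit \<Gamma> y G N s u)\<^sup>2" for s u
    have E_cong: "E (\<lambda>i\<in>{1..N}. \<tau> i \<omega>) u = E (\<lambda>i. \<tau> i \<omega>) u" for \<omega> u
      by (simp add: E_def sample_eq)
    have E_eq: "E s u = ((\<Sum>i=1..N. (s i \<bullet> f u)\<^sup>2) / real N - (norm (f u))\<^sup>2)\<^sup>2 / 4" for s u
      unfolding E_def \<Phi>_eq sample_eq by (simp add: power2_eq_square algebra_simps)
    have E_meas: "(\<lambda>(s, u). E s u) \<in> borel_measurable (PiM {1..N} (\<lambda>_. borel) \<Otimes>\<^sub>M \<mu>0)"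
      unfolding E_eq by measurable
    have \<tau>_meas: "(\<lambda>\<omega>. \<lambda>i\<in>{1..N}. \<tau> i \<omega>) \<in> measurable Q (PiM {1..N} (\<lambda>_. borel))"
      by measurable
    have E_\<tau>_meas: "(\<lambda>(\<omega>, u). E (\<lambda>i. \<tau> i \<omega>) u) \<in> borel_measurable (Q \<Otimes>\<^sub>M \<mu>0)"
      unfolding E_eq by measurable
    have variance: "(\<integral>\<^sup>+\<omega>. ennreal (E (\<lambda>i. \<tau> i \<omega>) u) \<partial>Q) \<le> ennreal (K\<^sup>2 / real N * (\<Phi> u)\<^sup>2)" for u
    proof -
      note mse = sparse_sample_mean_square_error_le[OF assms(5-8) Q N copies, where v = "f u"]
      have "(\<integral>\<^sup>+\<omega>. ennreal (E (\<lambda>i. \<tau> i \<omega>) u) \<partial>Q) = ennreal (\<integral>\<omega>. E (\<lambda>i. \<tau> i \<omega>) u \<partial>Q)"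
        using mse(1) by (intro nn_integral_eq_integral) (auto simp: E_eq)
      also have "(\<integral>\<omega>. E (\<lambda>i. \<tau> i \<omega>) u \<partial>Q) \<le> (K * (norm (f u))\<^sup>2)\<^sup>2 / real N / 4"
        using mse(2) by (simp add: E_eq K_def)
      also have "\<dots> = K\<^sup>2 / real N * (\<Phi> u)\<^sup>2"
        by (simp add: \<Phi>_eq power_mult_distrib power_divide)
      finally show ?thesis by (simp add: ennreal_leI)
    qed
    have "(\<integral>\<^sup>+s. ennreal ((hellinger_dist \<mu>0 (posterior \<mu>0 \<Phi>)
              (posterior \<mu>0 (sample_misfit \<Gamma> y G N s)))\<^sup>2) \<partial>joint_law Q {1..N} \<tau>)
        \<le> (\<integral>\<^sup>+s. ennreal (1 / (4 * Z)) * (\<integral>\<^sup>+u. ennreal (E s u) \<partial>\<mu>0) \<partial>joint_law Q {1..N} \<tau>)"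
      unfolding E_def by (intro nn_integral_mono stability(2))
    also have "\<dots> = (\<integral>\<^sup>+\<omega>. ennreal (1 / (4 * Z)) * (\<integral>\<^sup>+u. ennreal (E (\<lambda>i\<in>{1..N}. \<tau> i \<omega>) u) \<partial>\<mu>0) \<partial>Q)"
      unfolding joint_law_def using E_meas
      by (intro nn_integral_distr[OF \<tau>_meas] borel_measurable_times_ennreal borel_measurable_const
          \<mu>0.borel_measurable_nn_integral) (simp add: split_beta')
    also have "\<dots> = ennreal (1 / (4 * Z)) * (\<integral>\<^sup>+\<omega>. (\<integral>\<^sup>+u. ennreal (E (\<lambda>i. \<tau> i \<omega>) u) \<partial>\<mu>0) \<partial>Q)"
      unfolding E_cong using E_\<tau>_meas
      by (intro nn_integral_cmult \<mu>0.borel_measurable_nn_integral) (simp add: split_beta')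
    also have "(\<integral>\<^sup>+\<omega>. (\<integral>\<^sup>+u. ennreal (E (\<lambda>i. \<tau> i \<omega>) u) \<partial>\<mu>0) \<partial>Q)
        = (\<integral>\<^sup>+u. (\<integral>\<^sup>+\<omega>. ennreal (E (\<lambda>i. \<tau> i \<omega>) u) \<partial>Q) \<partial>\<mu>0)"
      using E_\<tau>_meas by (intro Fubini'[symmetric]) (simp add: split_beta')
    also have "\<dots> \<le> (\<integral>\<^sup>+u. ennreal (K\<^sup>2 / real N * (\<Phi> u)\<^sup>2) \<partial>\<mu>0)"
      by (intro nn_integral_mono variance)
    also have "\<dots> = ennreal (\<integral>u. K\<^sup>2 / real N * (\<Phi> u)\<^sup>2 \<partial>\<mu>0)"
      using assms(9) by (intro nn_integral_eq_integral) (auto simp: \<Phi>_def)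
    also have "ennreal (1 / (4 * Z)) * \<dots> = ennreal (R / real N)"
      using Z by (simp add: R_def ennreal_mult[symmetric])
    \<comment> \<open>A bound on the extended integral bounds the Bochner integral even before the integrand is
      known to be measurable in the samples.\<close>
    finally have "(\<integral>s. (hellinger_dist \<mu>0 (posterior \<mu>0 \<Phi>)
              (posterior \<mu>0 (sample_misfit \<Gamma> y G N s)))\<^sup>2 \<partial>joint_law Q {1..N} \<tau>) \<le> R / real N"
      using R by (intro integral_real_bounded) (auto simp: mult_left_mono)
    then show ?thesis
      by (simp add: real_sqrt_divide[symmetric])
  qed
  then show ?thesis unfolding \<Phi>_def by blast
qed

end
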